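(* Let $s$ be a positive integer. (i) Let $F$ be a graph and let $t\ge\max\{|E(F)|,s+1\}$. Then $\mathrm{ex}_t^{\sum}(n,\{F,M_{s+1}\})=\mathrm{ex}_s^{\sum}(n,F)+O(n)$. (ii) Let $t\ge\max\{|E(K_3)|,s+1\}=\max\{3,s+1\}$. For $n$ sufficiently large, we have $\mathrm{ex}_t^{\sum}(n,\{K_3,M_{s+1}\})=\mathrm{ex}_s^{\sum}(n,K_3)$.
   Context: All graphs are finite and simple. $M_k$ denotes the matching with $k$ edges, and $K_3$ the triangle. A collection $(G_1,\dots,G_t)$ consists of graphs on the same vertex set $V$; it is "on $n$ vertices" if $|V|=n$. A subgraph of the union of the $G_i$ is rainbow if for each edge $uv$ of it one can choose an index $i$ with $uv\in E(G_i)$ so that each $i$ is chosen at most once. For a family $\mathcal{H}$ of graphs, the collection is rainbow $\mathcal{H}$-free if there is no rainbow copy (as a not necessarily induced subgraph) of any member of $\mathcal{H}$. For a positive integer $t$, $\mathrm{ex}_t^{\sum}(n,\mathcal{H})$ is the largest value of $\sum_{i=1}^t |E(G_i)|$ among rainbow $\mathcal{H}$-free collections $(G_1,\dots,G_t)$ on $n$ vertices; for $\mathcal{H}=\{F\}$ one writes $\mathrm{ex}_t^{\sum}(n,F)$. The $O(n)$ term and "sufficiently large" are for $n\to\infty$ with $F,s,t$ fixed. *)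

theory Defs
  imports Complex_Main "HOL-Library.Ramsey" "HOL-Library.Landau_Symbols"
begin

text \<open>
  A graph is a pair of a vertex set and a set of two-element subsets of it;
  \<open>[V]\<^bsup>2\<^esup>\<close> is the library's notation for the set of two-element subsets of \<open>V\<close>.
\<close>

type_synonym 'a graph = "'a set \<times> 'a set set"

abbreviation verts :: "'a graph \<Rightarrow> 'a set" where
  "verts G \<equiv> fst G"

abbreviation edges :: "'a graph \<Rightarrow> 'a set set" where
  "edges G \<equiv> snd G"

definition simple_graph :: "'a graph \<Rightarrow> bool" where
  "simple_graph G \<longleftrightarrow> finite (verts G) \<and> edges G \<subseteq> [verts G]\<^bsup>2\<^esup>"

definition subgraph :: "'a graph \<Rightarrow> 'a graph \<Rightarrow> bool" where
  "subgraph S G \<longleftrightarrow> simple_graph S \<and> verts S \<subseteq> verts G \<and> edges S \<subseteq> edges G"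

definition isomorphic :: "'a graph \<Rightarrow> 'b graph \<Rightarrow> bool" where
  "isomorphic F S \<longleftrightarrow> (\<exists>f. bij_betw f (verts F) (verts S) \<and> edges S = (\<lambda>e. f ` e) ` edges F)"

definition matching :: "nat \<Rightarrow> nat graph" where
  "matching k = ({..<2 * k}, {{2 * i, 2 * i + 1} | i. i < k})"

definition triangle_graph :: "nat graph" where
  "triangle_graph = ({..<3}, [{..<3}]\<^bsup>2\<^esup>)"

text \<open>A collection \<open>(G\<^sub>1, \<dots>, G\<^sub>t)\<close> is a function of which only the values on \<open>{1..t}\<close> matter.\<close>

definition collection :: "nat \<Rightarrow> 'a set \<Rightarrow> (nat \<Rightarrow> 'a graph) \<Rightarrow> bool" where
  "collection t V G \<longleftrightarrow> (\<forall>i\<in>{1..t}. simple_graph (G i) \<and> verts (G i) = V)"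

definition union_graph :: "nat \<Rightarrow> 'a set \<Rightarrow> (nat \<Rightarrow> 'a graph) \<Rightarrow> 'a graph" where
  "union_graph t V G = (V, \<Union>i\<in>{1..t}. edges (G i))"

definition rainbow :: "nat \<Rightarrow> (nat \<Rightarrow> 'a graph) \<Rightarrow> 'a graph \<Rightarrow> bool" where
  "rainbow t G S \<longleftrightarrow>
     (\<exists>c. inj_on c (edges S) \<and> (\<forall>e\<in>edges S. c e \<in> {1..t} \<and> e \<in> edges (G (c e))))"

definition rainbow_free :: "nat \<Rightarrow> 'a set \<Rightarrow> (nat \<Rightarrow> 'a graph) \<Rightarrow> 'b graph set \<Rightarrow> bool" where
  "rainbow_free t V G \<H> \<longleftrightarrow>
     \<not> (\<exists>H\<in>\<H>. \<exists>S. subgraph S (union_graph t V G) \<and> rainbow t G S \<and> isomorphic H S)"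

definition ex_sums :: "nat \<Rightarrow> nat \<Rightarrow> 'b graph set \<Rightarrow> nat set" where
  "ex_sums t n \<H> =
     {\<Sum>i=1..t. card (edges (G i)) | G (V :: nat set).
        finite V \<and> card V = n \<and> collection t V G \<and> rainbow_free t V G \<H>}"

text \<open>
  The value set is always finite. It is empty only if some edgeless member of the
  family has at most \<open>n\<close> vertices; the extremal number is then a fixed unspecified number
  (the same one for all parameters).
\<close>

definition ex_sum :: "nat \<Rightarrow> nat \<Rightarrow> 'b graph set \<Rightarrow> nat" where
  "ex_sum t n \<H> = Max (ex_sums t n \<H>)"

lemma finite_ex_sums: "finite (ex_sums t n \<H>)"
proof -
  have "ex_sums t n \<H> \<subseteq> {..t * 2 ^ n}"
  proof
    fix m assume "m \<in> ex_sums t n \<H>"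
    then obtain G and V :: "nat set" where m: "m = (\<Sum>i=1..t. card (edges (G i)))"
      and V: "finite V" "card V = n" and G: "collection t V G"
      unfolding ex_sums_def by blast
    have "card (edges (G i)) \<le> 2 ^ n" if "i \<in> {1..t}" for i
    proof -
      have "edges (G i) \<subseteq> Pow V"
        using G that unfolding collection_def simple_graph_def nsets_def by blast
      then show ?thesis
        using V by (metis card_Pow card_mono finite_Pow_iff)
    qed
    then have "m \<le> (\<Sum>i=1..t. 2 ^ n)"
      unfolding m by (rule sum_mono)
    then show "m \<in> {..t * 2 ^ n}" by simp
  qed
  then show ?thesis by (rule finite_subset) simp
qed

lemma ex_sums_nonempty:
  assumes "\<And>H. H \<in> \<H> \<Longrightarrow> edges H \<noteq> {}"
  shows "ex_sums t n \<H> \<noteq> {}"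
proof -
  let ?G = "\<lambda>i :: nat. ({..<n}, {}) :: nat graph"
  have "collection t {..<n} ?G"
    by (simp add: collection_def simple_graph_def)
  moreover have "rainbow_free t {..<n} ?G \<H>"
    using assms by (fastforce simp: rainbow_free_def rainbow_def isomorphic_def)
  ultimately have "(\<Sum>i=1..t. card (edges (?G i))) \<in> ex_sums t n \<H>"
    unfolding ex_sums_def mem_Collect_eq
    by (intro exI[of _ ?G] exI[of _ "{..<n}"]) simp
  then show ?thesis by blast
qed

end

theory Submission
  imports Defs "HOL-Library.Disjoint_Sets"
begin

text \<open>
  Lower bounds: an extremal collection of \<open>s\<close> graphs, padded by empty graphs, has no rainbow
  matching with \<open>s + 1\<close> edges, since only \<open>s\<close> colours occur
  (\<open>ex_sum_le_ex_sum_matching\<close>).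

  Upper bounds: call a graph of the collection large if it has a matching with \<open>2 * s + 1\<close>
  edges. From \<open>s + 1\<close> large graphs one could pick a rainbow matching greedily, so at most \<open>s\<close> are
  large. Every other graph has a vertex cover of size at most \<open>4 * s\<close>, hence \<open>O(n)\<close> edges
  (\<open>rainbow_matching_free_structure\<close>). The large graphs alone form a rainbow \<open>F\<close>-free collection
  of at most \<open>s\<close> graphs, which proves the first part.

  Let \<open>F\<close> be the triangle. If exactly \<open>s\<close> graphs are large, the others are empty, since one of
  their edges could be completed to a rainbow matching greedily, and the bound is exact. If fewer
  are large, the collection has to be beaten by an explicit construction. Give a pair of
  vertices the number of its colours as weight. The key fact (\<open>heavy_pair\<close>) is that if \<open>u, v\<close>
  has weight at least three, then for any \<open>x\<close> one of \<open>u, x\<close> and \<open>v, x\<close> has no colour or both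
  have the same single colour. There are three ranges of \<open>s\<close>.

  \<^item> For \<open>s = 1\<close> there are \<open>O(n)\<close> edges in total, fewer than in one complete graph.

  \<^item> For \<open>s \<ge> 5\<close>, deleting heavy pairs as in Mantel's theorem (\<open>mantel_bound\<close>) shows that the large
    graphs have at most \<open>(s - 1) * n\<^sup>2 / 4\<close> edges, and \<open>s\<close> copies of a balanced complete bipartite
    graph have about \<open>n\<^sup>2 / 4\<close> edges more.

  \<^item> For \<open>2 \<le> s \<le> 4\<close> the target is two complete graphs with \<open>n * (n - 1)\<close> edges in total, and no
    linear error can be afforded. The covers form a bounded set \<open>R\<close>, outside of which all
    weights are at most three. Deleting vertices of degree less than \<open>2 * (n - 1)\<close> leads to the
    case that all degrees are at least that large. Heavy pairs force some degree to be smaller, so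
    all weights are at most two (\<open>min_degree_all_weights_le_2\<close>), and the bound
    follows (\<open>total_le_two_complete\<close>).
\<close>

section \<open>Rainbow copies in collections\<close>

lemma collectionD:
  assumes "collection t V G" "i \<in> {1..t}"
  shows "verts (G i) = V" "edges (G i) \<subseteq> [V]\<^bsup>2\<^esup>" "finite V"
  using assms unfolding collection_def simple_graph_def by auto

lemma rainbow_free_mono: "rainbow_free t V G \<H> \<Longrightarrow> \<H>' \<subseteq> \<H> \<Longrightarrow> rainbow_free t V G \<H>'"
  unfolding rainbow_free_def by blast

lemma isomorphic_card_edges:
  assumes "simple_graph H" "isomorphic H S"
  shows "card (edges S) = card (edges H)"
proof -
  obtain f where f: "bij_betw f (verts H) (verts S)" "edges S = (\<lambda>e. f ` e) ` edges H"
    using assms(2) unfolding isomorphic_def by blast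
  have "edges H \<subseteq> Pow (verts H)"
    using assms(1) unfolding simple_graph_def nsets_def by blast
  then have "inj_on (\<lambda>e. f ` e) (edges H)"
    using f(1) inj_on_image_Pow inj_on_subset unfolding bij_betw_def by blast
  then show ?thesis
    unfolding f(2) by (rule card_image)
qed

lemma simple_graph_triangle: "simple_graph triangle_graph"
  by (simp add: simple_graph_def triangle_graph_def)

lemma card_edges_triangle: "card (edges triangle_graph) = 3"
  by (simp add: triangle_graph_def choose_two)

lemma simple_graph_matching: "simple_graph (matching k)"
  by (auto simp: simple_graph_def matching_def nsets_def)

lemma card_edges_matching: "card (edges (matching k)) = k"
proof -
  have "edges (matching k) = (\<lambda>i. {2 * i, 2 * i + 1}) ` {..<k}"
    by (auto simp: matching_def)
  moreover have "inj_on (\<lambda>i. {2 * i, 2 * i + 1 :: nat}) {..<k}"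
    by (auto simp: inj_on_def doubleton_eq_iff)
  ultimately show ?thesis
    by (simp add: card_image)
qed

text \<open>A rainbow copy spends a different nonempty graph of the collection on each edge.\<close>

lemma rainbow_free_few_colours:
  assumes "finite I" "\<And>i. i \<in> {1..t} \<Longrightarrow> i \<notin> I \<Longrightarrow> edges (G i) = {}"
    and "\<And>H. H \<in> \<H> \<Longrightarrow> simple_graph H \<and> card I < card (edges H)"
  shows "rainbow_free t V G \<H>"
  unfolding rainbow_free_def
proof safe
  fix H S assume H: "H \<in> \<H>" "rainbow t G S" "isomorphic H S"
  then obtain c where c: "inj_on c (edges S)"
      "\<forall>e\<in>edges S. c e \<in> {1..t} \<and> e \<in> edges (G (c e))"
    unfolding rainbow_def by blast
  then have "c ` edges S \<subseteq> I"
    using assms(2) by blast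
  then have "card (edges S) \<le> card I"
    by (metis assms(1) c(1) card_image card_mono)
  then show False
    using isomorphic_card_edges H assms(3)[of H] by fastforce
qed

text \<open>
  A rainbow copy in the new collection uses no colour outside \<open>I\<close>, because those graphs are
  empty, and composing its colouring with the injection \<open>p\<close> turns it into a copy in the old one.
\<close>

lemma rainbow_free_reindex:
  assumes "rainbow_free t V G \<H>" "inj_on p I" "p ` I \<subseteq> {1..t}"
    and "\<And>i. i \<in> I \<Longrightarrow> G' i = G (p i)"
    and "\<And>i. i \<in> {1..s} \<Longrightarrow> i \<notin> I \<Longrightarrow> edges (G' i) = {}"
  shows "rainbow_free s V G' \<H>"
  unfolding rainbow_free_def
proof safe
  fix H S assume S: "H \<in> \<H>" "subgraph S (union_graph s V G')" "rainbow s G' S" "isomorphic H S"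
  from S(3) obtain c where c: "inj_on c (edges S)"
      "\<forall>e\<in>edges S. c e \<in> {1..s} \<and> e \<in> edges (G' (c e))"
    unfolding rainbow_def by blast
  have cI: "c e \<in> I" if "e \<in> edges S" for e
    using c(2) that assms(5) by blast
  have pc: "p (c e) \<in> {1..t} \<and> e \<in> edges (G (p (c e)))" if "e \<in> edges S" for e
    using c(2) cI[OF that] that assms(3,4) by auto
  have "inj_on (\<lambda>e. p (c e)) (edges S)"
    using c(1) assms(2) cI by (simp add: inj_on_def)
  then have "rainbow t G S"
    unfolding rainbow_def using pc by blast
  moreover have "edges S \<subseteq> (\<Union>i\<in>{1..t}. edges (G i))"
    using pc by blast
  then have "subgraph S (union_graph t V G)"
    using S(2) unfolding subgraph_def union_graph_def by simp
  ultimately show False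
    using assms(1) S(1,4) unfolding rainbow_free_def by blast
qed

text \<open>
  The edges are enumerated by \<open>p\<close>, and the vertices \<open>2 * j\<close> and \<open>2 * j + 1\<close> of the matching are
  sent to the ends of the edge number \<open>j\<close>.
\<close>

lemma rainbow_matching_of_disjoint_edges:
  assumes coll: "collection t V G" and I: "I \<subseteq> {1..t}" "card I = k"
    and e: "\<And>i. i \<in> I \<Longrightarrow> e i \<in> edges (G i)"
    and disj: "\<And>i j. i \<in> I \<Longrightarrow> j \<in> I \<Longrightarrow> i \<noteq> j \<Longrightarrow> e i \<inter> e j = {}"
    and H: "matching k \<in> \<H>"
  shows "\<not> rainbow_free t V G \<H>"
proof -
  have "finite I" using I(1) finite_subset by blast
  then obtain p where p: "bij_betw p {..<k} I"
    using ex_bij_betw_nat_finite[of I] I(2) by (auto simp: lessThan_atLeast0)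
  have pI: "p j \<in> I" if "j < k" for j
    using p that by (auto simp: bij_betw_def)
  have "\<exists>a b. e (p j) = {a, b} \<and> a \<noteq> b \<and> a \<in> V \<and> b \<in> V" if "j < k" for j
  proof -
    have "e (p j) \<in> [V]\<^bsup>2\<^esup>"
      using e[OF pI[OF that]] collectionD(2)[OF coll] pI[OF that] I(1) by blast
    then show ?thesis
      by (auto simp: nsets_def card_2_iff)
  qed
  then obtain a b where ab: "\<And>j. j < k \<Longrightarrow>
      e (p j) = {a j, b j} \<and> a j \<noteq> b j \<and> a j \<in> V \<and> b j \<in> V"
    by metis
  define f where "f m = (if even m then a (m div 2) else b (m div 2))" for m
  have f_edge: "e (p j) = {f (2 * j), f (2 * j + 1)}" if "j < k" for j
    using ab[OF that] by (simp add: f_def)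
  have fV: "f m \<in> V" and f_in: "f m \<in> e (p (m div 2))" if "m < 2 * k" for m
  proof -
    have "m div 2 < k" using that by linarith
    then show "f m \<in> V" "f m \<in> e (p (m div 2))"
      using ab[of "m div 2"] by (auto simp: f_def)
  qed
  have inj: "inj_on f {..<2 * k}"
  proof (rule inj_onI)
    fix m m' assume m: "m \<in> {..<2 * k}" "m' \<in> {..<2 * k}" "f m = f m'"
    then have k: "m div 2 < k" "m' div 2 < k" by auto
    have "p (m div 2) = p (m' div 2)"
      using disj[OF pI[OF k(1)] pI[OF k(2)]] f_in[of m] f_in[of m'] m by auto
    then have eq: "m div 2 = m' div 2"
      using p k by (auto simp: bij_betw_def inj_on_def)
    have "even m \<longleftrightarrow> even m'"
      using m(3) ab[OF k(2)] eq by (auto simp: f_def split: if_splits)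
    with eq show "m = m'"
      by (metis div_mult_mod_eq mod2_eq_if)
  qed
  define S where "S = (f ` {..<2 * k}, e ` I)"
  have eI: "e ` I = (\<lambda>j. {f (2 * j), f (2 * j + 1)}) ` {..<k}"
  proof -
    have "e ` I = (\<lambda>j. e (p j)) ` {..<k}"
      using p by (auto simp: bij_betw_def)
    also have "\<dots> = (\<lambda>j. {f (2 * j), f (2 * j + 1)}) ` {..<k}"
      by (rule image_cong) (auto simp: f_edge)
    finally show ?thesis .
  qed
  have "edges (matching k) = (\<lambda>j. {2 * j, 2 * j + 1}) ` {..<k}"
    by (auto simp: matching_def)
  then have "edges S = (\<lambda>x. f ` x) ` edges (matching k)"
    by (simp add: S_def eI image_image)
  then have iso: "isomorphic (matching k) S"
    unfolding isomorphic_def using inj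
    by (intro exI[of _ f]) (auto simp: S_def matching_def bij_betw_def)
  have "edges S \<subseteq> [verts S]\<^bsup>2\<^esup>"
  proof
    fix x assume "x \<in> edges S"
    then obtain j where j: "j < k" "x = {f (2 * j), f (2 * j + 1)}"
      by (auto simp: S_def eI)
    moreover have "f (2 * j) \<noteq> f (2 * j + 1)"
      using ab[OF j(1)] by (simp add: f_def)
    ultimately show "x \<in> [verts S]\<^bsup>2\<^esup>"
      by (auto simp: nsets_def S_def)
  qed
  then have sub: "subgraph S (union_graph t V G)"
    using fV e I(1)
    unfolding subgraph_def simple_graph_def union_graph_def S_def by (auto intro!: imageI)
  have "\<forall>x\<in>edges S. inv_into I e x \<in> {1..t} \<and> x \<in> edges (G (inv_into I e x))"
  proof
    fix x assume "x \<in> edges S"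
    then have x: "x \<in> e ` I" by (simp add: S_def)
    then show "inv_into I e x \<in> {1..t} \<and> x \<in> edges (G (inv_into I e x))"
      using inv_into_into[OF x] e[OF inv_into_into[OF x]] I(1) f_inv_into_f[OF x] by auto
  qed
  moreover have "inj_on (inv_into I e) (edges S)"
    by (simp add: S_def inj_on_inv_into)
  ultimately have "rainbow t G S"
    unfolding rainbow_def by blast
  with iso sub H show ?thesis
    unfolding rainbow_free_def by blast
qed

lemma rainbow_triangle_of_distinct_colours:
  assumes coll: "collection t V G" and ijk: "{i, j, k} \<subseteq> {1..t}" "i \<noteq> j" "j \<noteq> k" "i \<noteq> k"
    and e: "{x, y} \<in> edges (G i)" "{y, z} \<in> edges (G j)" "{x, z} \<in> edges (G k)"
    and H: "triangle_graph \<in> \<H>"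
  shows "\<not> rainbow_free t V G \<H>"
proof -
  have E: "{x, y} \<in> [V]\<^bsup>2\<^esup>" "{y, z} \<in> [V]\<^bsup>2\<^esup>" "{x, z} \<in> [V]\<^bsup>2\<^esup>"
    using e collectionD(2)[OF coll] ijk(1) by blast+
  then have d: "x \<noteq> y" "y \<noteq> z" "x \<noteq> z" and V: "x \<in> V" "y \<in> V" "z \<in> V"
    by (auto simp: nsets_def)
  define S where "S = ({x, y, z}, {{x, y}, {y, z}, {x, z}})"
  define f where "f m = (if m = 0 then x else if m = 1 then y else z)" for m :: nat
  have three: "{..<3} = {0, 1, 2 :: nat}" by auto
  have T: "edges triangle_graph = {{0, 1}, {1, 2}, {0, 2}}"
    unfolding triangle_graph_def three
    by (auto simp: nsets_def dest!: card_2_iff[THEN iffD1])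
  have "bij_betw f (verts triangle_graph) (verts S)"
    using d by (auto simp: bij_betw_def inj_on_def triangle_graph_def three S_def f_def)
  moreover have "edges S = (\<lambda>e. f ` e) ` edges triangle_graph"
    unfolding T by (auto simp: S_def f_def)
  ultimately have iso: "isomorphic triangle_graph S"
    unfolding isomorphic_def by blast
  have sub: "subgraph S (union_graph t V G)"
    using V d e ijk(1)
    by (auto simp: subgraph_def simple_graph_def union_graph_def S_def nsets_def)
  let ?c = "\<lambda>e. if e = {x, y} then i else if e = {y, z} then j else k"
  have "rainbow t G S"
    unfolding rainbow_def
    using d ijk e by (intro exI[of _ ?c]) (auto simp: S_def inj_on_def doubleton_eq_iff)
  with iso sub H show ?thesis
    unfolding rainbow_free_def by blast
qed

section \<open>Subcollections and extremal numbers\<close>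

lemma ex_sum_ge:
  fixes V :: "nat set"
  assumes "finite V" "card V = n" "collection t V G" "rainbow_free t V G \<H>"
  shows "(\<Sum>i=1..t. card (edges (G i))) \<le> ex_sum t n \<H>"
    and "ex_sums t n \<H> \<noteq> {}"
proof -
  have "(\<Sum>i=1..t. card (edges (G i))) \<in> ex_sums t n \<H>"
    unfolding ex_sums_def mem_Collect_eq using assms by blast
  then show "(\<Sum>i=1..t. card (edges (G i))) \<le> ex_sum t n \<H>" "ex_sums t n \<H> \<noteq> {}"
    unfolding ex_sum_def by (auto intro: Max_ge finite_ex_sums)
qed

lemma ex_sum_attained:
  assumes "ex_sums t n \<H> \<noteq> {}"
  obtains G and V :: "nat set" where "finite V" "card V = n" "collection t V G"
    "rainbow_free t V G \<H>" "ex_sum t n \<H> = (\<Sum>i=1..t. card (edges (G i)))"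
proof -
  have "ex_sum t n \<H> \<in> ex_sums t n \<H>"
    unfolding ex_sum_def by (rule Max_in[OF finite_ex_sums assms])
  then show ?thesis
    using that unfolding ex_sums_def mem_Collect_eq by blast
qed

text \<open>
  The graphs with index in \<open>B\<close>, renumbered and padded by empty graphs, compete for \<open>ex_sum s\<close>. The
  second claim makes sure that the maximum defining \<open>ex_sum s\<close> exists whenever the one for
  \<open>t\<close> does.
\<close>

lemma sum_subcollection_le_ex_sum:
  fixes V :: "nat set"
  assumes V: "finite V" "card V = n" and G: "collection t V G" "rainbow_free t V G \<H>"
    and B: "B \<subseteq> {1..t}" "card B \<le> s"
  shows "(\<Sum>i\<in>B. card (edges (G i))) \<le> ex_sum s n \<H>"
    and "ex_sums s n \<H> \<noteq> {}"
proof -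
  have "finite B" using B(1) finite_subset by blast
  then obtain p where p: "bij_betw p {1..card B} B"
    using ex_bij_betw_nat_finite_1 by blast
  then have pB: "inj_on p {1..card B}" "p ` {1..card B} = B"
    by (auto simp: bij_betw_def)
  define G' where "G' i = (if i \<in> {1..card B} then G (p i) else (V, {}))" for i
  have "collection s V G'"
    unfolding collection_def
  proof
    fix i
    show "simple_graph (G' i) \<and> verts (G' i) = V"
    proof (cases "i \<in> {1..card B}")
      case True
      then have "p i \<in> {1..t}" using pB(2) B(1) by blast
      then show ?thesis using True G(1) by (simp add: G'_def collection_def)
    next
      case False
      then show ?thesis using V(1) by (auto simp: G'_def simple_graph_def)
    qed
  qed
  moreover have "rainbow_free s V G' \<H>"
    by (rule rainbow_free_reindex[OF G(2) pB(1)]) (use pB(2) B(1) in \<open>auto simp: G'_def\<close>)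
  ultimately have le: "(\<Sum>i=1..s. card (edges (G' i))) \<le> ex_sum s n \<H>"
    and ne: "ex_sums s n \<H> \<noteq> {}"
    using ex_sum_ge[OF V] by blast+
  show "ex_sums s n \<H> \<noteq> {}" by (rule ne)
  have "(\<Sum>i\<in>B. card (edges (G i))) = (\<Sum>i=1..card B. card (edges (G (p i))))"
    using sum.reindex_bij_betw[OF p, of "\<lambda>i. card (edges (G i))"] by simp
  also have "\<dots> = (\<Sum>i=1..card B. card (edges (G' i)))"
    by (rule sum.cong) (auto simp: G'_def)
  also have "\<dots> \<le> (\<Sum>i=1..s. card (edges (G' i)))"
    using B(2) by (intro sum_mono2) auto
  finally show "(\<Sum>i\<in>B. card (edges (G i))) \<le> ex_sum s n \<H>"
    using le by linarith
qed

text \<open>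
  Padding an extremal collection of \<open>s\<close> graphs by empty graphs creates no rainbow copy, and
  \<open>s\<close> colours cannot form a rainbow matching with \<open>s + 1\<close> edges.
\<close>

lemma ex_sum_le_ex_sum_matching:
  assumes "s \<le> t" "ex_sums s n {F} \<noteq> {}"
  shows "ex_sum s n {F} \<le> ex_sum t n {F, matching (s + 1)}"
    and "ex_sums t n {F, matching (s + 1)} \<noteq> {}"
proof -
  obtain G and V :: "nat set" where V: "finite V" "card V = n" and G: "collection s V G"
    "rainbow_free s V G {F}" and eq: "ex_sum s n {F} = (\<Sum>i=1..s. card (edges (G i)))"
    using ex_sum_attained[OF assms(2)] by blast
  define G' where "G' i = (if i \<in> {1..s} then G i else (V, {}))" for i
  have "collection t V G'"
    using G(1) V(1) by (auto simp: collection_def G'_def simple_graph_def)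
  moreover have "rainbow_free t V G' {F}"
    by (rule rainbow_free_reindex[OF G(2), of id "{1..s}"]) (auto simp: G'_def)
  moreover have "rainbow_free t V G' {matching (s + 1)}"
    by (rule rainbow_free_few_colours[of "{1..s}"])
      (auto simp: G'_def simple_graph_matching card_edges_matching simp del: One_nat_def)
  ultimately have "collection t V G'" "rainbow_free t V G' {F, matching (s + 1)}"
    unfolding rainbow_free_def by auto
  note le = ex_sum_ge[OF V this]
  show "ex_sums t n {F, matching (s + 1)} \<noteq> {}" by (rule le(2))
  have "ex_sum s n {F} = (\<Sum>i=1..s. card (edges (G' i)))"
    unfolding eq by (rule sum.cong) (auto simp: G'_def)
  also have "\<dots> \<le> (\<Sum>i=1..t. card (edges (G' i)))"
    using assms(1) by (intro sum_mono2) auto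
  finally show "ex_sum s n {F} \<le> ex_sum t n {F, matching (s + 1)}"
    using le(1) by linarith
qed

section \<open>Large matchings and small covers\<close>

text \<open>The vertices of a maximal matching meet every edge.\<close>

lemma maximal_disjoint_subfamily_covers:
  assumes "E \<subseteq> [V]\<^bsup>2\<^esup>" "finite V"
    and small: "\<And>M. M \<subseteq> E \<Longrightarrow> disjoint M \<Longrightarrow> card M \<le> m"
  obtains R where "R \<subseteq> V" "card R \<le> 2 * m" "\<And>e. e \<in> E \<Longrightarrow> e \<inter> R \<noteq> {}"
proof -
  have "finite E" using assms(1,2) finite_imp_finite_nsets finite_subset by blast
  define \<M> where "\<M> = {M. M \<subseteq> E \<and> disjoint M}"
  have "finite \<M>" "\<M> \<noteq> {}"
    using \<open>finite E\<close> by (auto simp: \<M>_def intro: exI[of _ "{}"])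
  then obtain M where "M \<in> \<M>" "\<forall>M'\<in>\<M>. M \<subseteq> M' \<longrightarrow> M = M'"
    using finite_has_maximal[of \<M>] by auto
  then have M: "M \<subseteq> E" "disjoint M"
    and max: "\<And>M'. M' \<subseteq> E \<Longrightarrow> disjoint M' \<Longrightarrow> M \<subseteq> M' \<Longrightarrow> M = M'"
    by (simp_all add: \<M>_def)
  have M2: "\<And>e. e \<in> M \<Longrightarrow> e \<subseteq> V \<and> card e = 2"
    using M(1) assms(1) by (auto simp: nsets_def)
  show ?thesis
  proof
    show "\<Union>M \<subseteq> V" using M2 by blast
    have "card (\<Union>M) \<le> (\<Sum>e\<in>M. card e)"
      by (rule card_Union_le_sum_card)
    also have "\<dots> = 2 * card M" using M2 by simp
    also have "\<dots> \<le> 2 * m" using small[OF M] by simp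
    finally show "card (\<Union>M) \<le> 2 * m" .
    fix e assume e: "e \<in> E"
    show "e \<inter> \<Union>M \<noteq> {}"
    proof
      assume "e \<inter> \<Union>M = {}"
      then have "disjoint (insert e M)"
        using M(2) by (auto simp: disjoint_def)
      then have "M = insert e M"
        using max[of "insert e M"] M(1) e by blast
      with \<open>e \<inter> \<Union>M = {}\<close> have "e = {}" by blast
      with e assms(1) show False by (auto simp: nsets_def)
    qed
  qed
qed

lemma disjoint_family_avoids:
  assumes "disjoint M" "finite Y" "card Y < card M"
  shows "\<exists>e\<in>M. e \<inter> Y = {}"
proof (rule ccontr)
  assume "\<not> ?thesis"
  then have "\<forall>e\<in>M. \<exists>x. x \<in> e \<inter> Y" by blast
  then obtain g where g: "\<And>e. e \<in> M \<Longrightarrow> g e \<in> e \<inter> Y"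
    by metis
  have "inj_on g M"
    using assms(1) g unfolding inj_on_def disjoint_def by (metis Int_iff empty_iff)
  then have "card M \<le> card Y"
    using g assms(2) by (intro card_inj_on_le[of g]) auto
  with assms(3) show False by simp
qed

text \<open>
  Edges can be picked greedily, one from each family: the vertices blocked by \<open>X\<close> and the
  earlier edges are too few to meet every edge of a large matching.
\<close>

lemma greedy_disjoint_edges:
  assumes "finite I" "finite X" "card X + 2 * card I \<le> m + 1"
    and E: "\<And>i. i \<in> I \<Longrightarrow> \<exists>M \<subseteq> E i. disjoint M \<and> card M \<ge> m"
    and two: "\<And>i e. i \<in> I \<Longrightarrow> e \<in> E i \<Longrightarrow> card e = 2"
  shows "\<exists>e. (\<forall>i\<in>I. e i \<in> E i \<and> e i \<inter> X = {}) \<and> (\<forall>i\<in>I. \<forall>j\<in>I. i \<noteq> j \<longrightarrow> e i \<inter> e j = {})"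
  using assms
proof (induction I rule: finite_induct)
  case empty
  then show ?case by simp
next
  case (insert k I)
  have "\<exists>e. (\<forall>i\<in>I. e i \<in> E i \<and> e i \<inter> X = {}) \<and> (\<forall>i\<in>I. \<forall>j\<in>I. i \<noteq> j \<longrightarrow> e i \<inter> e j = {})"
    by (rule insert.IH) (use insert.prems insert.hyps in auto)
  then obtain e where e: "\<And>i. i \<in> I \<Longrightarrow> e i \<in> E i \<and> e i \<inter> X = {}"
      "\<And>i j. i \<in> I \<Longrightarrow> j \<in> I \<Longrightarrow> i \<noteq> j \<Longrightarrow> e i \<inter> e j = {}"
    by blast
  have e2: "\<And>i. i \<in> I \<Longrightarrow> card (e i) = 2"
    using e(1) insert.prems(4) by blast
  let ?Y = "X \<union> (\<Union>i\<in>I. e i)"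
  obtain M where M: "M \<subseteq> E k" "disjoint M" "card M \<ge> m"
    using insert.prems(3) by blast
  have "card ?Y \<le> card X + (\<Sum>i\<in>I. card (e i))"
    using card_Un_le[of X "\<Union>i\<in>I. e i"] card_UN_le[OF insert.hyps(1), of e] by linarith
  then have "card ?Y \<le> card X + 2 * card I"
    using e2 by simp
  then have "card ?Y < card M"
    using insert.prems(2) insert.hyps M(3) by simp
  moreover have "finite ?Y"
    using insert.prems(1) insert.hyps(1) e2 by (auto intro: card_ge_0_finite)
  ultimately obtain e' where e': "e' \<in> M" "e' \<inter> ?Y = {}"
    using disjoint_family_avoids[OF M(2)] by blast
  show ?case
    using e e' M(1) insert.hyps(2) by (intro exI[of _ "e(k := e')"]) auto
qed

text \<open>
  The set \<open>B\<close> consists of the graphs with a matching of size \<open>2 * s + 1\<close>. This size lets the greedy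
  choice find \<open>s + 1\<close> disjoint edges in \<open>s + 1\<close> such graphs, or \<open>s\<close> in \<open>s\<close> such graphs that also avoid
  one given edge; both would be rainbow matchings. The set \<open>R\<close> is the union of covers of the
  graphs outside \<open>B\<close>, each having at most twice \<open>2 * s\<close> vertices.
\<close>

lemma rainbow_matching_free_structure:
  assumes coll: "collection t V G" and V: "finite V"
    and free: "rainbow_free t V G {matching (s + 1)}"
  obtains B R where "B \<subseteq> {1..t}" "card B \<le> s"
    "card B = s \<Longrightarrow> (\<forall>i\<in>{1..t} - B. edges (G i) = {})"
    "R \<subseteq> V" "card R \<le> 4 * s * t"
    "\<And>i e. i \<in> {1..t} - B \<Longrightarrow> e \<in> edges (G i) \<Longrightarrow> e \<inter> R \<noteq> {}"
proof -
  define B where "B = {i \<in> {1..t}. \<exists>M \<subseteq> edges (G i). disjoint M \<and> card M \<ge> 2 * s + 1}"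
  have B: "B \<subseteq> {1..t}" and finB: "finite B" by (auto simp: B_def)
  have big: "\<exists>M \<subseteq> edges (G i). disjoint M \<and> card M \<ge> 2 * s + 1" if "i \<in> B" for i
    using that by (simp add: B_def)
  have two: "card e = 2" if "i \<in> {1..t}" "e \<in> edges (G i)" for i e
    using collectionD(2)[OF coll that(1)] that(2) by (auto simp: nsets_def)
  have no_matching: False if "I \<subseteq> {1..t}" "card I = s + 1" "\<And>i. i \<in> I \<Longrightarrow> e i \<in> edges (G i)"
      "\<And>i j. i \<in> I \<Longrightarrow> j \<in> I \<Longrightarrow> i \<noteq> j \<Longrightarrow> e i \<inter> e j = {}" for I e
    using rainbow_matching_of_disjoint_edges[OF coll that, of "{matching (s + 1)}"] free by simp
  have cardB: "card B \<le> s"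
  proof (rule ccontr)
    assume "\<not> card B \<le> s"
    then obtain I where I: "I \<subseteq> B" "card I = s + 1"
      by (metis Suc_eq_plus1 not_less_eq_eq obtain_subset_with_card_n)
    have "\<exists>e. (\<forall>i\<in>I. e i \<in> edges (G i) \<and> e i \<inter> {} = {}) \<and>
        (\<forall>i\<in>I. \<forall>j\<in>I. i \<noteq> j \<longrightarrow> e i \<inter> e j = {})"
      by (rule greedy_disjoint_edges[where m = "2 * s + 1"])
        (use I B big two finite_subset[OF I(1) finB] in \<open>simp_all, blast+\<close>)
    then show False
      using no_matching[of I] I B by blast
  qed
  have full: "edges (G k) = {}" if s: "card B = s" and k: "k \<in> {1..t} - B" for k
  proof (rule ccontr)
    assume "edges (G k) \<noteq> {}"
    then obtain x where x: "x \<in> edges (G k)" by blast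
    then have x2: "card x = 2" using two k by blast
    have "\<exists>e. (\<forall>i\<in>B. e i \<in> edges (G i) \<and> e i \<inter> x = {}) \<and>
        (\<forall>i\<in>B. \<forall>j\<in>B. i \<noteq> j \<longrightarrow> e i \<inter> e j = {})"
      by (rule greedy_disjoint_edges[where m = "2 * s + 1"])
        (use x2 s B big two finB card_ge_0_finite[of x] in \<open>simp_all, blast+\<close>)
    then obtain e where e: "\<And>i. i \<in> B \<Longrightarrow> e i \<in> edges (G i) \<and> e i \<inter> x = {}"
        "\<And>i j. i \<in> B \<Longrightarrow> j \<in> B \<Longrightarrow> i \<noteq> j \<Longrightarrow> e i \<inter> e j = {}"
      by blast
    show False
    proof (rule no_matching[of "insert k B" "e(k := x)"])
      show "insert k B \<subseteq> {1..t}" "card (insert k B) = s + 1"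
        using k B s finB by auto
      show "(e(k := x)) i \<in> edges (G i)" if "i \<in> insert k B" for i
        using that e(1) x by auto
      fix i j assume "i \<in> insert k B" "j \<in> insert k B" "i \<noteq> j"
      then show "(e(k := x)) i \<inter> (e(k := x)) j = {}"
        using e(1)[of i] e(1)[of j] e(2)[of i j] by (cases "i = k"; cases "j = k") auto
    qed
  qed
  have "\<exists>R. R \<subseteq> V \<and> card R \<le> 4 * s \<and> (\<forall>e\<in>edges (G i). e \<inter> R \<noteq> {})" if i: "i \<in> {1..t} - B" for i
  proof -
    have small: "card M \<le> 2 * s" if "M \<subseteq> edges (G i)" "disjoint M" for M
    proof (rule ccontr)
      assume "\<not> card M \<le> 2 * s"
      then have "card M \<ge> 2 * s + 1" by simp
      then have "i \<in> B" using that i unfolding B_def by blast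
      with i show False by simp
    qed
    have "edges (G i) \<subseteq> [V]\<^bsup>2\<^esup>" using collectionD(2)[OF coll] i by blast
    then obtain R where "R \<subseteq> V" "card R \<le> 2 * (2 * s)" "\<And>e. e \<in> edges (G i) \<Longrightarrow> e \<inter> R \<noteq> {}"
      using maximal_disjoint_subfamily_covers[OF _ V small] by metis
    then show ?thesis by auto
  qed
  then obtain R where R: "\<And>i. i \<in> {1..t} - B \<Longrightarrow>
      R i \<subseteq> V \<and> card (R i) \<le> 4 * s \<and> (\<forall>e\<in>edges (G i). e \<inter> R i \<noteq> {})"
    by metis
  show ?thesis
  proof
    show "B \<subseteq> {1..t}" "card B \<le> s" by (fact B cardB)+
    show "\<forall>i\<in>{1..t} - B. edges (G i) = {}" if "card B = s"
      using full that by blast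
    let ?R = "\<Union>i\<in>{1..t} - B. R i"
    show "?R \<subseteq> V" using R by blast
    have "card ?R \<le> (\<Sum>i\<in>{1..t} - B. card (R i))"
      by (rule card_UN_le) simp
    also have "\<dots> \<le> (\<Sum>i\<in>{1..t} - B. 4 * s)"
      using R by (intro sum_mono) blast
    also have "\<dots> \<le> 4 * s * t"
      using card_mono[of "{1..t}" "{1..t} - B"] by simp
    finally show "card ?R \<le> 4 * s * t" .
    show "e \<inter> ?R \<noteq> {}" if "i \<in> {1..t} - B" "e \<in> edges (G i)" for i e
      using R that by blast
  qed
qed

lemma card_edges_le_cover:
  assumes "E \<subseteq> [V]\<^bsup>2\<^esup>" "finite V" "R \<subseteq> V" "\<And>e. e \<in> E \<Longrightarrow> e \<inter> R \<noteq> {}"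
  shows "card E \<le> card R * card V"
proof -
  have "E \<subseteq> (\<lambda>(x, y). {x, y}) ` (R \<times> V)"
  proof
    fix e assume e: "e \<in> E"
    then obtain x where x: "x \<in> e" "x \<in> R" using assms(4) by blast
    moreover obtain y where "e = {x, y}" "y \<in> V"
      using e x(1) assms(1) by (auto simp: nsets_def card_2_iff subset_iff)
    ultimately show "e \<in> (\<lambda>(x, y). {x, y}) ` (R \<times> V)" by auto
  qed
  moreover have "finite (R \<times> V)" using assms(2,3) finite_subset by blast
  ultimately have "card E \<le> card (R \<times> V)"
    by (meson card_image_le card_mono finite_imageI le_trans)
  then show ?thesis by (simp add: card_cartesian_product)
qed

lemma sum_le_large_plus_linear:
  assumes coll: "collection t V G" and V: "finite V" "card V = n" and B: "B \<subseteq> {1..t}"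
    and R: "R \<subseteq> V" "card R \<le> r"
      "\<And>i e. i \<in> {1..t} - B \<Longrightarrow> e \<in> edges (G i) \<Longrightarrow> e \<inter> R \<noteq> {}"
  shows "(\<Sum>i=1..t. card (edges (G i))) \<le> (\<Sum>i\<in>B. card (edges (G i))) + t * r * n"
proof -
  have "card (edges (G i)) \<le> r * n" if i: "i \<in> {1..t} - B" for i
  proof -
    have "edges (G i) \<subseteq> [V]\<^bsup>2\<^esup>" using collectionD(2)[OF coll] i by blast
    from card_edges_le_cover[OF this V(1) R(1) R(3)[OF i]] show ?thesis
      using R(2) V(2) by (meson le_trans mult_le_mono1 order_refl)
  qed
  then have "(\<Sum>i\<in>{1..t} - B. card (edges (G i))) \<le> (\<Sum>i\<in>{1..t} - B. r * n)"
    by (intro sum_mono) blast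
  also have "\<dots> \<le> t * r * n"
    using card_mono[of "{1..t}" "{1..t} - B"] by simp
  finally show ?thesis
    using sum.subset_diff[OF B, of "\<lambda>i. card (edges (G i))"] by simp
qed

lemma ex_sum_matching_le:
  assumes "ex_sums t n {F, matching (s + 1)} \<noteq> {}"
  shows "ex_sum t n {F, matching (s + 1)} \<le> ex_sum s n {F} + t * (4 * s * t) * n"
    and "ex_sums s n {F} \<noteq> {}"
proof -
  obtain G and V :: "nat set" where V: "finite V" "card V = n" and G: "collection t V G"
    "rainbow_free t V G {F, matching (s + 1)}"
    and eq: "ex_sum t n {F, matching (s + 1)} = (\<Sum>i=1..t. card (edges (G i)))"
    using ex_sum_attained[OF assms] by blast
  have free: "rainbow_free t V G {matching (s + 1)}" "rainbow_free t V G {F}"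
    using rainbow_free_mono[OF G(2)] by auto
  obtain B R where BR: "B \<subseteq> {1..t}" "card B \<le> s" "R \<subseteq> V" "card R \<le> 4 * s * t"
    "\<And>i e. i \<in> {1..t} - B \<Longrightarrow> e \<in> edges (G i) \<Longrightarrow> e \<inter> R \<noteq> {}"
    using rainbow_matching_free_structure[OF G(1) V(1) free(1)] by metis
  show "ex_sum t n {F, matching (s + 1)} \<le> ex_sum s n {F} + t * (4 * s * t) * n"
  proof -
    have "(\<Sum>i=1..t. card (edges (G i))) \<le>
        (\<Sum>i\<in>B. card (edges (G i))) + t * (4 * s * t) * n"
      by (rule sum_le_large_plus_linear[OF G(1) V BR(1,3,4)]) (rule BR(5))
    then show ?thesis
      using sum_subcollection_le_ex_sum(1)[OF V G(1) free(2) BR(1,2)] unfolding eq by linarith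
  qed
  show "ex_sums s n {F} \<noteq> {}"
    by (rule sum_subcollection_le_ex_sum(2)[OF V G(1) free(2) BR(1,2)])
qed

section \<open>Colourings without rainbow triangles\<close>

locale rainbow_triangle_free_colouring =
  fixes c :: "'a \<Rightarrow> 'a \<Rightarrow> nat set"
  assumes sym: "c x y = c y x"
    and irrefl: "c x x = {}"
    and no_rainbow: "i \<in> c x y \<Longrightarrow> j \<in> c y z \<Longrightarrow> k \<in> c x z \<Longrightarrow> i = j \<or> j = k \<or> i = k"
begin

definition weight :: "'a \<Rightarrow> 'a \<Rightarrow> nat" where
  "weight x y = card (c x y)"

definition degree :: "'a set \<Rightarrow> 'a \<Rightarrow> nat" where
  "degree A x = (\<Sum>y\<in>A. weight x y)"

text \<open>Each unordered pair counts twice.\<close>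

definition total :: "'a set \<Rightarrow> nat" where
  "total A = (\<Sum>x\<in>A. degree A x)"

lemma weight_sym: "weight x y = weight y x"
  by (simp add: weight_def sym)

lemma weight_irrefl [simp]: "weight x x = 0"
  by (simp add: weight_def irrefl)

lemma degree_insert:
  "finite A \<Longrightarrow> x \<notin> A \<Longrightarrow> degree (insert x A) y = weight y x + degree A y"
  by (simp add: degree_def)

lemma total_insert:
  assumes "finite A" "x \<notin> A"
  shows "total (insert x A) = total A + 2 * degree A x"
proof -
  have "total (insert x A) = degree (insert x A) x + (\<Sum>y\<in>A. degree (insert x A) y)"
    using assms by (simp add: total_def)
  also have "\<dots> = degree A x + ((\<Sum>y\<in>A. weight x y) + total A)"
    using assms by (simp add: degree_insert total_def sum.distrib weight_sym[of _ x])
  finally show ?thesis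
    by (simp add: degree_def)
qed

lemma total_le:
  assumes "finite A" "\<And>x y. x \<in> A \<Longrightarrow> y \<in> A \<Longrightarrow> weight x y \<le> m"
  shows "total A \<le> m * (card A * (card A - 1))"
proof -
  have "degree A x \<le> m * (card A - 1)" if x: "x \<in> A" for x
  proof -
    have "degree A x = (\<Sum>y\<in>A - {x}. weight x y)"
      using x assms(1) by (simp add: degree_def sum.remove)
    also have "\<dots> \<le> (\<Sum>y\<in>A - {x}. m)"
      using assms(2) x by (intro sum_mono) blast
    also have "\<dots> = m * (card A - 1)"
      using x assms(1) by simp
    finally show ?thesis .
  qed
  then have "total A \<le> (\<Sum>x\<in>A. m * (card A - 1))"
    unfolding total_def by (rule sum_mono)
  then show ?thesis by (simp add: algebra_simps)
qed

text \<open>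
  Three colours on one side of a triangle leave a choice different from any two colours of the
  other sides, so these sides cannot carry two different colours.
\<close>

lemma heavy_pair:
  assumes "3 \<le> weight u v"
  shows "weight u x = 0 \<or> weight v x = 0 \<or> weight u x = 1 \<and> weight v x = 1"
proof (rule ccontr)
  assume neg: "\<not> ?thesis"
  have same: "b = d" if "b \<in> c v x" "d \<in> c u x" for b d
  proof (rule ccontr)
    assume "b \<noteq> d"
    have "\<not> c u v \<subseteq> {b, d}"
    proof
      assume "c u v \<subseteq> {b, d}"
      then have "card (c u v) \<le> card {b, d}" by (intro card_mono) auto
      then show False using assms \<open>b \<noteq> d\<close> by (simp add: weight_def)
    qed
    then obtain a where "a \<in> c u v" "a \<noteq> b" "a \<noteq> d" by blast
    then show False using no_rainbow[of a u v b x d] that \<open>b \<noteq> d\<close> by blast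
  qed
  have "c u x \<noteq> {}" "c v x \<noteq> {}"
    using neg by (auto simp: weight_def)
  then obtain a where "c u x = {a}" "c v x = {a}"
    using same by blast
  then show False using neg by (simp add: weight_def)
qed

text \<open>
  Mantel's argument: by the previous lemma, deleting the two ends of a pair of weight at least three
  loses weight at most \<open>k\<close> towards each of the other \<open>n - 2\<close> vertices and at most \<open>k\<close> between the ends,
  which makes \<open>k * (n - 1)\<close>, exactly the decrease of \<open>k * n\<^sup>2 / 4\<close>. If there is no such pair,
  all weights are at most \<open>2\<close>, and \<open>2 * (n choose 2)\<close> is small enough because \<open>k \<ge> 4\<close>.
\<close>

lemma mantel_bound:
  assumes "finite A" "4 \<le> k" "\<And>x y. x \<in> A \<Longrightarrow> y \<in> A \<Longrightarrow> weight x y \<le> k"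
  shows "2 * total A \<le> k * (card A)\<^sup>2"
  using assms(1,3)
proof (induction "card A" arbitrary: A rule: less_induct)
  case less
  show ?case
  proof (cases "\<exists>u\<in>A. \<exists>v\<in>A. 3 \<le> weight u v")
    case False
    then have "weight x y \<le> 2" if "x \<in> A" "y \<in> A" for x y
      using that by fastforce
    then have "2 * total A \<le> 4 * (card A * (card A - 1))"
      using total_le[of A 2] less.prems(1) by simp
    also have "\<dots> \<le> k * (card A)\<^sup>2"
      unfolding power2_eq_square using assms(2) by (intro mult_le_mono) auto
    finally show ?thesis .
  next
    case True
    then obtain u v where uv: "u \<in> A" "v \<in> A" "3 \<le> weight u v" by blast
    then have "u \<noteq> v" by auto
    define A' where "A' = A - {u, v}"
    have A': "finite A'" "u \<notin> A'" "v \<notin> insert u A'" "A = insert v (insert u A')"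
      using less.prems(1) uv \<open>u \<noteq> v\<close> by (auto simp: A'_def)
    define m where "m = card A'"
    have card: "card A = m + 2"
      using A' by (simp add: m_def)
    have "degree A' u + degree A' v = (\<Sum>y\<in>A'. weight u y + weight v y)"
      by (simp add: degree_def sum.distrib)
    also have "\<dots> \<le> (\<Sum>y\<in>A'. k)"
    proof (rule sum_mono)
      fix y assume "y \<in> A'"
      then have "weight u y \<le> k" "weight v y \<le> k"
        using less.prems(2) uv by (auto simp: A'_def)
      then show "weight u y + weight v y \<le> k"
        using heavy_pair[OF uv(3), of y] assms(2) by auto
    qed
    finally have deg: "degree A' u + degree A' v \<le> m * k"
      by (simp add: m_def)
    have "2 * total A' \<le> k * m\<^sup>2"
      unfolding m_def
      by (rule less.hyps) (use A' less.prems card m_def in auto)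
    moreover have "weight v u \<le> k" using less.prems(2) uv by blast
    moreover have "2 * total A = 2 * total A' + 4 * (degree A' u + degree A' v) + 4 * weight v u"
      using A' by (simp add: total_insert degree_insert)
    ultimately have "2 * total A \<le> k * m\<^sup>2 + 4 * (m * k) + 4 * k"
      using deg by (simp add: add_mono)
    also have "\<dots> = k * (card A)\<^sup>2"
      unfolding card by (simp add: power2_eq_square algebra_simps)
    finally show ?thesis .
  qed
qed

end

lemma sum_le_split:
  fixes f :: "'a \<Rightarrow> nat"
  assumes "finite U" "finite R" "card R \<le> r"
    and "\<And>y. y \<in> U \<Longrightarrow> y \<notin> R \<Longrightarrow> f y \<le> p" "\<And>y. y \<in> U \<Longrightarrow> f y \<le> q"
  shows "sum f U \<le> p * card U + q * r"
proof -
  have "sum f U = sum f (U - R) + sum f (U \<inter> R)"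
    using assms(1) by (metis Int_commute add.commute sum.Int_Diff)
  moreover have "sum f (U - R) \<le> p * card U"
  proof -
    have "sum f (U - R) \<le> (\<Sum>y\<in>U - R. p)"
      by (rule sum_mono) (use assms(4) in auto)
    also have "\<dots> \<le> p * card U"
      using assms(1) by (simp add: card_mono)
    finally show ?thesis .
  qed
  moreover have "sum f (U \<inter> R) \<le> q * r"
  proof -
    have "sum f (U \<inter> R) \<le> (\<Sum>y\<in>U \<inter> R. q)"
      by (rule sum_mono) (use assms(5) in auto)
    also have "\<dots> \<le> q * r"
      using card_mono[of R "U \<inter> R"] assms(2,3) by simp
    finally show ?thesis .
  qed
  ultimately show ?thesis by linarith
qed

context rainbow_triangle_free_colouring
begin

text \<open>
  If \<open>u, v\<close> had weight at least three, then \<open>u\<close> and \<open>v\<close> together would send weight at most three to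
  every vertex outside \<open>R\<close>, whereas their degrees ask for almost four on average.
\<close>

lemma min_degree_weight_le_2:
  assumes U: "finite U" and R: "finite R" "card R \<le> r"
    and t: "\<And>x y. x \<in> U \<Longrightarrow> y \<in> U \<Longrightarrow> weight x y \<le> t"
    and deg: "\<And>x. x \<in> U \<Longrightarrow> 2 * card U \<le> degree U x + 2"
    and large: "2 * t * r + 4 < card U"
    and uv: "u \<in> U" "v \<in> U"
    and light: "\<And>y. y \<in> U \<Longrightarrow> y \<notin> R \<Longrightarrow> weight u y \<le> 3 \<and> weight v y \<le> 3"
  shows "weight u v \<le> 2"
proof (rule ccontr)
  assume "\<not> weight u v \<le> 2"
  then have "3 \<le> weight u v" by simp
  note heavy = heavy_pair[OF this]
  have "degree U u + degree U v = (\<Sum>y\<in>U. weight u y + weight v y)"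
    by (simp add: degree_def sum.distrib)
  also have "\<dots> \<le> 3 * card U + (2 * t) * r"
  proof (rule sum_le_split[OF U R])
    show "weight u y + weight v y \<le> 3" if "y \<in> U" "y \<notin> R" for y
      using heavy[of y] light[OF that] by auto
    show "weight u y + weight v y \<le> 2 * t" if "y \<in> U" for y
      using t[OF uv(1) that] t[OF uv(2) that] by simp
  qed
  finally show False
    using deg[OF uv(1)] deg[OF uv(2)] large by linarith
qed

text \<open>
  The pairs outside \<open>R\<close> are light by the previous lemma. If \<open>x\<close> lies outside \<open>R\<close> and \<open>x, u\<close> is
  heavy, then every \<open>y\<close> with \<open>weight x y = 2\<close> has \<open>weight u y = 0\<close>; hence the combination
  \<open>t * weight x y + weight u y\<close> is at most \<open>2 * t\<close> for all \<open>y\<close> outside \<open>R\<close>, and the degrees of \<open>x\<close>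
  and \<open>u\<close> cannot both be as large as \<open>2 * (n - 1)\<close>. The pairs inside \<open>R\<close> are then light by the
  previous lemma again.
\<close>

lemma min_degree_all_weights_le_2:
  assumes U: "finite U" and R: "finite R" "card R \<le> r"
    and t: "\<And>x y. x \<in> U \<Longrightarrow> y \<in> U \<Longrightarrow> weight x y \<le> t"
    and out: "\<And>x y. x \<in> U \<Longrightarrow> x \<notin> R \<Longrightarrow> y \<in> U \<Longrightarrow> y \<notin> R \<Longrightarrow> weight x y \<le> 3"
    and deg: "\<And>x. x \<in> U \<Longrightarrow> 2 * card U \<le> degree U x + 2"
    and large: "t * t * r + 2 * t * r + 2 * t + 4 < card U"
    and uv: "u \<in> U" "v \<in> U"
  shows "weight u v \<le> 2"
proof -
  have large': "2 * t * r + 4 < card U" using large by linarith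
  note light_pair = min_degree_weight_le_2[OF U R t deg large']
  have out2: "weight x y \<le> 2" if "x \<in> U" "x \<notin> R" "y \<in> U" "y \<notin> R" for x y
    by (rule light_pair) (use that out in auto)
  have mixed: "weight x u \<le> 2" if x: "x \<in> U" "x \<notin> R" and u: "u \<in> U" for x u
  proof (rule ccontr)
    assume "\<not> weight x u \<le> 2"
    then have "3 \<le> weight x u" by simp
    note heavy = heavy_pair[OF this]
    have "t * degree U x + degree U u = (\<Sum>y\<in>U. t * weight x y + weight u y)"
      by (simp add: degree_def sum.distrib sum_distrib_left)
    also have "\<dots> \<le> (2 * t) * card U + (t * t + t) * r"
    proof (rule sum_le_split[OF U R])
      fix y assume y: "y \<in> U"
      note le_t = t[OF x(1) y] t[OF u y]
      show "t * weight x y + weight u y \<le> t * t + t"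
        using le_t by (intro add_mono mult_le_mono) auto
      assume "y \<notin> R"
      then have "weight x y \<le> 2" using out2 x y by blast
      then consider "weight x y = 0" | "weight x y = 1" | "weight x y = 2" by linarith
      then show "t * weight x y + weight u y \<le> 2 * t"
        using heavy[of y] le_t by cases auto
    qed
    finally have "t * degree U x + degree U u \<le> 2 * t * card U + (t * t + t) * r" .
    moreover have "t * (2 * card U) \<le> t * (degree U x + 2)"
      using deg[OF x(1)] by (rule mult_le_mono2)
    ultimately have "2 * card U \<le> 2 * t + 2 + (t * t + t) * r"
      using deg[OF u] by (simp add: algebra_simps)
    then show False using large by (simp add: algebra_simps)
  qed
  show ?thesis
    by (rule light_pair[OF _ _ _ uv]) (use mixed uv weight_sym in fastforce)+
qed

text \<open>
  Suppose \<open>V\<close> exceeds the bound. Deleting a vertex lowers the bound \<open>n * (n - 1)\<close> by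
  \<open>2 * (n - 1)\<close>, so deleting vertices of smaller degree increases the excess each time. As the
  excess is at most quadratic in the number of remaining vertices, this stops at a
  set \<open>U\<close> that is still large. In \<open>U\<close> all weights are at most \<open>2\<close>, so it does not exceed the bound.
\<close>

lemma total_le_two_complete:
  assumes V: "finite V" and R: "finite R" "card R \<le> r"
    and t: "\<And>x y. x \<in> V \<Longrightarrow> y \<in> V \<Longrightarrow> weight x y \<le> t"
    and out: "\<And>x y. x \<in> V \<Longrightarrow> x \<notin> R \<Longrightarrow> y \<in> V \<Longrightarrow> y \<notin> R \<Longrightarrow> weight x y \<le> 3"
    and n1: "n1 = t * t * r + 2 * t * r + 2 * t + 4"
    and large: "t * (n1 * n1) + n1 < card V"
  shows "total V \<le> 2 * (card V * (card V - 1))"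
proof (rule ccontr)
  assume exceeds: "\<not> ?thesis"
  (* The excess of U is larger than the number of deleted vertices; the factors 2 are there
     because the total counts every pair twice. A smallest such U is where the deletion stops. *)
  define P where "P U \<longleftrightarrow> U \<subseteq> V \<and>
    2 * (card U * (card U - 1)) + 1 + 2 * (card V - card U) \<le> total U" for U
  have "P V" using exceeds by (simp add: P_def)
  then obtain U where U: "P U" "\<And>U'. P U' \<Longrightarrow> card U \<le> card U'"
    using ex_has_least_nat[of P V card] by blast
  have UV: "U \<subseteq> V" and finU: "finite U"
    and tot: "2 * (card U * (card U - 1)) + 1 + 2 * (card V - card U) \<le> total U"
    using U(1) V finite_subset by (auto simp: P_def)
  have tU: "weight x y \<le> t" if "x \<in> U" "y \<in> U" for x y
    using t UV that by blast
  (* At most n1 remaining vertices carry total weight at most t * n1 * n1, less than the number of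
     deleted vertices. *)
  have large_U: "n1 < card U"
  proof (rule ccontr)
    assume "\<not> n1 < card U"
    then have le: "card U \<le> n1" by simp
    have "total U \<le> t * (card U * (card U - 1))"
      by (rule total_le[OF finU tU])
    also have "\<dots> \<le> t * (n1 * n1)"
      using le by (intro mult_le_mono) auto
    finally show False using tot large le by linarith
  qed
  have deg: "2 * card U \<le> degree U x + 2" if x: "x \<in> U" for x
  proof (rule ccontr)
    assume neg: "\<not> 2 * card U \<le> degree U x + 2"
    define U' where "U' = U - {x}"
    have U': "finite U'" "x \<notin> U'" "U = insert x U'"
      using x finU by (auto simp: U'_def)
    have "card V \<ge> card U" using UV V by (rule card_mono[rotated])
    have card: "card U = Suc (card U')" using U' by simp
    have "total U = total U' + 2 * degree U' x"
      unfolding U'(3) by (rule total_insert[OF U'(1,2)])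
    moreover have "degree U x = degree U' x"
      using U' by (simp add: degree_def)
    moreover have "card U * (card U - 1) = card U' * (card U' - 1) + 2 * card U'"
      unfolding card by (cases "card U'") auto
    ultimately have "P U'"
      using neg tot card \<open>card V \<ge> card U\<close> UV U' unfolding P_def by auto
    then show False using U(2)[of U'] card by simp
  qed
  have "weight u v \<le> 2" if "u \<in> U" "v \<in> U" for u v
    by (rule min_degree_all_weights_le_2[OF finU R tU _ deg _ that])
      (use out UV large_U n1 in auto)
  then have "total U \<le> 2 * (card U * (card U - 1))"
    by (rule total_le[OF finU])
  then show False using tot by linarith
qed

end

section \<open>Colour sets of a collection\<close>

definition colours :: "nat set \<Rightarrow> (nat \<Rightarrow> 'a graph) \<Rightarrow> 'a \<Rightarrow> 'a \<Rightarrow> nat set" where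
  "colours I G x y = {i \<in> I. {x, y} \<in> edges (G i)}"

lemma card_ordered_edges:
  assumes "E \<subseteq> [V]\<^bsup>2\<^esup>" "finite V"
  shows "card {p \<in> V \<times> V. {fst p, snd p} \<in> E} = 2 * card E"
proof -
  have finE: "finite E"
    using assms finite_imp_finite_nsets finite_subset by blast
  have two: "card {p \<in> V \<times> V. {fst p, snd p} = e} = 2" if "e \<in> E" for e
  proof -
    have "e \<in> [V]\<^bsup>2\<^esup>" using assms(1) that by blast
    then obtain a b where ab: "e = {a, b}" "a \<noteq> b" "a \<in> V" "b \<in> V"
      by (auto simp: nsets_def card_2_iff)
    then have "{p \<in> V \<times> V. {fst p, snd p} = e} = {(a, b), (b, a)}"
      by (auto simp: doubleton_eq_iff)
    with ab(2) show ?thesis by simp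
  qed
  have "{p \<in> V \<times> V. {fst p, snd p} \<in> E} = (\<Union>e\<in>E. {p \<in> V \<times> V. {fst p, snd p} = e})"
    by auto
  also have "card \<dots> = (\<Sum>e\<in>E. card {p \<in> V \<times> V. {fst p, snd p} = e})"
    using finE assms(2) by (intro card_UN_disjoint) auto
  finally show ?thesis using two by simp
qed

lemma sum_card_colours:
  assumes "\<And>i. i \<in> I \<Longrightarrow> edges (G i) \<subseteq> [V]\<^bsup>2\<^esup>" "finite V" "finite I"
  shows "(\<Sum>x\<in>V. \<Sum>y\<in>V. card (colours I G x y)) = 2 * (\<Sum>i\<in>I. card (edges (G i)))"
proof -
  have "(\<Sum>x\<in>V. \<Sum>y\<in>V. card (colours I G x y)) =
      (\<Sum>p\<in>V \<times> V. card {i \<in> I. {fst p, snd p} \<in> edges (G i)})"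
    by (simp add: sum.cartesian_product colours_def case_prod_unfold)
  also have "\<dots> = (\<Sum>i\<in>I. card {p \<in> V \<times> V. {fst p, snd p} \<in> edges (G i)})"
    using assms(2,3) by (intro sum_multicount_gen) auto
  also have "\<dots> = (\<Sum>i\<in>I. 2 * card (edges (G i)))"
    using assms by (intro sum.cong refl card_ordered_edges) auto
  finally show ?thesis by (simp add: sum_distrib_left)
qed


lemma colouring_of_collection:
  assumes "collection t V G" "rainbow_free t V G {triangle_graph}" "I \<subseteq> {1..t}"
  shows "rainbow_triangle_free_colouring (colours I G)"
proof
  show "colours I G x y = colours I G y x" for x y
    by (simp add: colours_def insert_commute)
  show "colours I G x x = {}" for x
  proof -
    have "{x, x} \<notin> edges (G i)" if "i \<in> I" for i
    proof -
      have "edges (G i) \<subseteq> [V]\<^bsup>2\<^esup>"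
        using collectionD(2)[OF assms(1)] that assms(3) by blast
      then show ?thesis by (auto simp: nsets_def)
    qed
    then show ?thesis by (auto simp: colours_def)
  qed
  fix i j k x y z
  assume "i \<in> colours I G x y" "j \<in> colours I G y z" "k \<in> colours I G x z"
  then have "{i, j, k} \<subseteq> {1..t}" "{x, y} \<in> edges (G i)" "{y, z} \<in> edges (G j)" "{x, z} \<in> edges (G k)"
    using assms(3) by (auto simp: colours_def)
  then show "i = j \<or> j = k \<or> i = k"
    using rainbow_triangle_of_distinct_colours[OF assms(1), of i j k x y z "{triangle_graph}"] assms(2)
    by blast
qed

lemma triangle_free_sum_le_mantel:
  assumes coll: "collection t V G" and V: "finite V"
    and free: "rainbow_free t V G {triangle_graph}"
    and B: "B \<subseteq> {1..t}" "card B \<le> k" and k: "4 \<le> k"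
  shows "4 * (\<Sum>i\<in>B. card (edges (G i))) \<le> k * (card V)\<^sup>2"
proof -
  interpret rainbow_triangle_free_colouring "colours B G"
    by (rule colouring_of_collection[OF coll free B(1)])
  have finB: "finite B" using B(1) finite_subset by blast
  have weight: "weight x y \<le> k" for x y
  proof -
    have "card (colours B G x y) \<le> card B"
      using finB by (intro card_mono) (auto simp: colours_def)
    then show ?thesis using B(2) by (simp add: weight_def)
  qed
  have "edges (G i) \<subseteq> [V]\<^bsup>2\<^esup>" if "i \<in> B" for i
    using collectionD(2)[OF coll] that B(1) by blast
  then have "total V = 2 * (\<Sum>i\<in>B. card (edges (G i)))"
    using sum_card_colours[of B G V] V finB by (simp add: total_def degree_def weight_def)
  then show ?thesis
    using mantel_bound[OF V k weight] by simp
qed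

text \<open>
  This keeps all \<open>t\<close> colours: a pair that avoids \<open>R\<close> has only colours of \<open>B\<close>, so its weight
  is at most three.
\<close>

lemma triangle_free_sum_le_two_complete:
  assumes coll: "collection t V G" and V: "finite V"
    and free: "rainbow_free t V G {triangle_graph}"
    and B: "B \<subseteq> {1..t}" "card B \<le> 3"
    and R: "R \<subseteq> V" "card R \<le> r"
      "\<And>i e. i \<in> {1..t} - B \<Longrightarrow> e \<in> edges (G i) \<Longrightarrow> e \<inter> R \<noteq> {}"
    and n1: "n1 = t * t * r + 2 * t * r + 2 * t + 4"
    and large: "t * (n1 * n1) + n1 < card V"
  shows "(\<Sum>i=1..t. card (edges (G i))) \<le> card V * (card V - 1)"
proof -
  interpret rainbow_triangle_free_colouring "colours {1..t} G"
    by (rule colouring_of_collection[OF coll free order_refl])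
  have finB: "finite B" using B(1) finite_subset by blast
  have weight: "weight x y \<le> t" for x y
  proof -
    have "card (colours {1..t} G x y) \<le> card {1..t}"
      by (rule card_mono) (auto simp: colours_def)
    then show ?thesis by (simp add: weight_def del: One_nat_def)
  qed
  have out: "weight x y \<le> 3" if "x \<notin> R" "y \<notin> R" for x y
  proof -
    have "colours {1..t} G x y \<subseteq> B"
      using R(3) that by (fastforce simp: colours_def)
    then have "card (colours {1..t} G x y) \<le> card B"
      by (rule card_mono[OF finB])
    then show ?thesis using B(2) by (simp add: weight_def del: One_nat_def)
  qed
  have "total V = 2 * (\<Sum>i=1..t. card (edges (G i)))"
    using sum_card_colours[of "{1..t}" G V] V collectionD(2)[OF coll]
    by (simp add: total_def degree_def weight_def del: One_nat_def)
  moreover have "total V \<le> 2 * (card V * (card V - 1))"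
    by (rule total_le_two_complete[OF V _ R(2) weight out n1 large])
      (use R(1) V finite_subset in auto)
  ultimately show ?thesis by simp
qed

section \<open>Constructions without rainbow triangles\<close>

text \<open>Take \<open>m\<close> complete graphs: two colours are too few for a rainbow triangle.\<close>

lemma ex_sum_triangle_ge_complete:
  assumes "m \<le> 2" "m \<le> s"
  shows "m * (n choose 2) \<le> ex_sum s n {triangle_graph}"
proof -
  define G where "G i = ({..<n}, if i \<in> {1..m} then [{..<n}]\<^bsup>2\<^esup> else {})" for i :: nat
  have "collection s {..<n} G"
    by (simp add: collection_def simple_graph_def G_def)
  moreover have "rainbow_free s {..<n} G {triangle_graph}"
    by (rule rainbow_free_few_colours[of "{1..m}"])
      (use assms(1) in \<open>auto simp: G_def simple_graph_triangle card_edges_triangle\<close>)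
  ultimately have "(\<Sum>i=1..s. card (edges (G i))) \<le> ex_sum s n {triangle_graph}"
    by (intro ex_sum_ge) auto
  moreover have "(\<Sum>i=1..m. card (edges (G i))) \<le> (\<Sum>i=1..s. card (edges (G i)))"
    using assms(2) by (intro sum_mono2) auto
  moreover have "(\<Sum>i=1..m. card (edges (G i))) = m * (n choose 2)"
    by (simp add: G_def)
  ultimately show ?thesis by linarith
qed

text \<open>Take \<open>s\<close> copies of the balanced complete bipartite graph, so that the union has no triangle.\<close>

lemma ex_sum_triangle_ge_bipartite:
  "s * ((n div 2) * (n - n div 2)) \<le> ex_sum s n {triangle_graph}"
proof -
  define h where "h = n div 2"
  define E where "E = (\<lambda>(x, y). {x, y}) ` ({..<h} \<times> {h..<n})"
  have "inj_on (\<lambda>(x, y). {x, y}) ({..<h} \<times> {h..<n})"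
    by (auto simp: inj_on_def doubleton_eq_iff)
  then have card: "card E = h * (n - h)"
    by (simp add: E_def card_image card_cartesian_product)
  have side: "(a < h) \<noteq> (b < h)" if "{a, b} \<in> E" for a b
    using that by (auto simp: E_def doubleton_eq_iff)
  define G where "G i = ({..<n}, E)" for i :: nat
  have "h \<le> n" by (simp add: h_def)
  then have coll: "collection s {..<n} G"
    by (auto simp: collection_def simple_graph_def G_def E_def nsets_def)
  have False
    if S: "subgraph S (union_graph s {..<n} G)" "isomorphic triangle_graph S" for S
  proof -
    obtain f where f: "edges S = (\<lambda>e. f ` e) ` edges triangle_graph"
      using S(2) unfolding isomorphic_def by blast
    have "edges S \<subseteq> E"
      using S(1) by (auto simp: subgraph_def union_graph_def G_def split: if_splits)
    moreover have "{0, 1} \<in> edges triangle_graph" "{1, 2} \<in> edges triangle_graph"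
        "{0, 2} \<in> edges triangle_graph"
      by (auto simp: triangle_graph_def nsets_def)
    then have "f ` {0, 1} \<in> edges S" "f ` {1, 2} \<in> edges S" "f ` {0, 2} \<in> edges S"
      unfolding f by blast+
    ultimately have "{f 0, f 1} \<in> E" "{f 1, f 2} \<in> E" "{f 0, f 2} \<in> E"
      by auto
    then show False using side by blast
  qed
  then have "rainbow_free s {..<n} G {triangle_graph}"
    unfolding rainbow_free_def by blast
  then have "(\<Sum>i=1..s. card (edges (G i))) \<le> ex_sum s n {triangle_graph}"
    using coll by (intro ex_sum_ge) auto
  then show ?thesis by (simp add: G_def card h_def)
qed

lemma two_choose_two: "2 * (n choose 2) = n * (n - 1)"
proof -
  have "even (n * (n - 1))" by (cases n) auto
  then show ?thesis by (simp add: choose_two)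
qed

lemma four_times_half_product: "n\<^sup>2 \<le> 4 * ((n div 2) * (n - n div 2)) + 1" for n :: nat
proof (cases "even n")
  case True
  then obtain k where "n = 2 * k" by blast
  then show ?thesis by (simp add: power2_eq_square)
next
  case False
  then obtain k where "n = 2 * k + 1" using oddE by blast
  then show ?thesis by (simp add: power2_eq_square algebra_simps)
qed

section \<open>The extremal number for triangles and matchings\<close>

text \<open>
  If fewer than \<open>s\<close> graphs are large, the collection is compared with one complete graph, two
  complete graphs or \<open>s\<close> bipartite graphs, depending on \<open>s\<close>. The first condition in \<open>large\<close> serves the range
  \<open>2 \<le> s \<le> 4\<close>; the second makes \<open>t * r * n\<close>, the number of edges outside the large
  graphs, smaller than the quadratic gap in the other two ranges.
\<close>

lemma triangle_sum_le_ex_sum: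
  fixes V :: "nat set"
  assumes s: "s \<ge> 1" and V: "finite V" "card V = n" and coll: "collection t V G"
    and free: "rainbow_free t V G {triangle_graph, matching (s + 1)}"
    and r: "r = 4 * s * t" and n1: "n1 = t * t * r + 2 * t * r + 2 * t + 4"
    and large: "t * (n1 * n1) + n1 < n" "4 * (t * r) + s < n"
  shows "(\<Sum>i=1..t. card (edges (G i))) \<le> ex_sum s n {triangle_graph}"
proof -
  have free': "rainbow_free t V G {matching (s + 1)}" "rainbow_free t V G {triangle_graph}"
    using rainbow_free_mono[OF free] by auto
  obtain B R where B: "B \<subseteq> {1..t}" "card B \<le> s"
      "card B = s \<Longrightarrow> (\<forall>i\<in>{1..t} - B. edges (G i) = {})"
    and R: "R \<subseteq> V" "card R \<le> r"
      "\<And>i e. i \<in> {1..t} - B \<Longrightarrow> e \<in> edges (G i) \<Longrightarrow> e \<inter> R \<noteq> {}"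
    using rainbow_matching_free_structure[OF coll V(1) free'(1)] unfolding r by metis
  have le: "(\<Sum>i=1..t. card (edges (G i))) \<le> (\<Sum>i\<in>B. card (edges (G i))) + t * r * n"
    by (rule sum_le_large_plus_linear[OF coll V B(1) R(1,2)]) (rule R(3))
  have n: "n \<ge> 1" using large by simp
  consider "card B = s" | "card B < s" "s = 1" | "card B < s" "2 \<le> s" "s \<le> 4" | "card B < s" "5 \<le> s"
    using B(2) s by linarith
  then show ?thesis
  proof cases
    case 1
    then have "(\<Sum>i=1..t. card (edges (G i))) = (\<Sum>i\<in>B. card (edges (G i)))"
      using B(1,3) by (intro sum.mono_neutral_right) auto
    then show ?thesis
      using sum_subcollection_le_ex_sum(1)[OF V coll free'(2) B(1,2)] by simp
  next
    case 2
    then have "B = {}" using B(1) finite_subset by fastforce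
    then have "2 * (\<Sum>i=1..t. card (edges (G i))) \<le> n * (2 * (t * r))"
      using le by (simp add: mult.commute)
    also have "\<dots> \<le> n * (n - 1)"
      using large by (intro mult_le_mono2) simp
    also have "\<dots> = 2 * (n choose 2)"
      by (simp add: two_choose_two)
    finally show ?thesis
      using ex_sum_triangle_ge_complete[of 1 s n] s by simp
  next
    case 3
    have "(\<Sum>i=1..t. card (edges (G i))) \<le> card V * (card V - 1)"
      by (rule triangle_free_sum_le_two_complete[OF coll V(1) free'(2) B(1) _ R(1,2) _ n1])
        (use 3 R(3) large V(2) in auto)
    also have "\<dots> = 2 * (n choose 2)"
      using V(2) by (simp add: two_choose_two)
    finally show ?thesis
      using ex_sum_triangle_ge_complete[of 2 s n] 3 by linarith
  next
    case 4
    define q where "q = (n div 2) * (n - n div 2)"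
    have "4 * (\<Sum>i\<in>B. card (edges (G i))) \<le> (s - 1) * n\<^sup>2"
      using triangle_free_sum_le_mantel[OF coll V(1) free'(2) B(1), of "s - 1"] 4 V(2) by simp
    moreover have "s * n\<^sup>2 = (s - 1) * n\<^sup>2 + n\<^sup>2"
      using s by (cases s) auto
    moreover have "4 * (t * r * n) + s \<le> n\<^sup>2"
    proof -
      have "4 * (t * r * n) + s \<le> (4 * (t * r) + s) * n"
        using n by (simp add: algebra_simps)
      also have "\<dots> \<le> n * n" using large by (intro mult_le_mono1) simp
      finally show ?thesis by (simp add: power2_eq_square)
    qed
    moreover have "s * n\<^sup>2 \<le> s * (4 * q + 1)"
      unfolding q_def by (intro mult_le_mono2 four_times_half_product)
    moreover have "s * (4 * q + 1) = 4 * (s * q) + s"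
      by (simp add: distrib_left)
    ultimately have "4 * (\<Sum>i=1..t. card (edges (G i))) \<le> 4 * (s * q)"
      using le by linarith
    then show ?thesis
      using ex_sum_triangle_ge_bipartite[of s n] by (simp add: q_def)
  qed
qed

theorem theorem1p2:
  fixes s :: nat
  assumes "s \<ge> 1"
  shows
    "(\<forall>(F :: nat graph) t. simple_graph F \<and> t \<ge> max (card (edges F)) (s + 1) \<longrightarrow>
        (\<lambda>n. real (ex_sum t n {F, matching (s + 1)}) - real (ex_sum s n {F})) \<in> O(\<lambda>n. real n))
     \<and>
     (\<forall>t. t \<ge> max (card (edges triangle_graph)) (s + 1) \<longrightarrow>
        (\<forall>\<^sub>F n in sequentially.
           ex_sum t n {triangle_graph, matching (s + 1)} = ex_sum s n {triangle_graph}))"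
proof (intro conjI allI impI)
  fix F :: "nat graph" and t
  assume "simple_graph F \<and> t \<ge> max (card (edges F)) (s + 1)"
  then have st: "s \<le> t" by simp
  have "\<bar>real (ex_sum t n {F, matching (s + 1)}) - real (ex_sum s n {F})\<bar>
      \<le> real (t * (4 * s * t)) * real n" for n
  proof (cases "ex_sums s n {F} = {}")
    case True
    \<comment> \<open>Here \<open>F\<close> is edgeless, and both extremal numbers are the unspecified \<open>Max {}\<close>.\<close>
    then have "ex_sums t n {F, matching (s + 1)} = {}"
      using ex_sum_matching_le(2) by blast
    with True show ?thesis by (simp add: ex_sum_def)
  next
    case False
    note lower = ex_sum_le_ex_sum_matching[OF st False]
    have "real (ex_sum t n {F, matching (s + 1)}) \<le> real (ex_sum s n {F} + t * (4 * s * t) * n)"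
      using ex_sum_matching_le(1)[OF lower(2)] by (rule of_nat_mono)
    then show ?thesis using lower(1) by simp
  qed
  then show "(\<lambda>n. real (ex_sum t n {F, matching (s + 1)}) - real (ex_sum s n {F})) \<in> O(\<lambda>n. real n)"
    by (intro bigoI[of _ "real (t * (4 * s * t))"] always_eventually allI) simp
next
  fix t assume "t \<ge> max (card (edges triangle_graph)) (s + 1)"
  then have st: "s \<le> t" by simp
  define r where "r = 4 * s * t"
  define n1 where "n1 = t * t * r + 2 * t * r + 2 * t + 4"
  have "ex_sum t n {triangle_graph, matching (s + 1)} = ex_sum s n {triangle_graph}"
    if large: "t * (n1 * n1) + n1 < n" "4 * (t * r) + s < n" for n
  proof -
    have "ex_sums s n {triangle_graph} \<noteq> {}"
      using card_edges_triangle by (intro ex_sums_nonempty) auto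
    note lower = ex_sum_le_ex_sum_matching[OF st this]
    obtain G and V :: "nat set" where V: "finite V" "card V = n" "collection t V G"
        "rainbow_free t V G {triangle_graph, matching (s + 1)}"
      and eq: "ex_sum t n {triangle_graph, matching (s + 1)} = (\<Sum>i=1..t. card (edges (G i)))"
      using ex_sum_attained[OF lower(2)] by blast
    show ?thesis
      using triangle_sum_le_ex_sum[OF assms V r_def n1_def large] lower(1) eq by linarith
  qed
  then show "\<forall>\<^sub>F n in sequentially.
      ex_sum t n {triangle_graph, matching (s + 1)} = ex_sum s n {triangle_graph}"
    by (intro eventually_sequentiallyI[of "t * (n1 * n1) + n1 + 4 * (t * r) + s + 1"]) auto
qed

end
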